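(* Let $S$ be a finite set, let $R\subseteq S\times S$ be a binary relation and let $m$ be a $1$-bounded pseudometric on $S$ such that for all $s,t\in S$: $s\,R\,t$ if and only if $m(s,t)=0$. Then for all distributions $\Delta,\Theta\in\mathcal{D}(S)$: $\Delta\ \overline{R}\ \Theta$ if and only if $\hat{m}(\Delta,\Theta)=0$.
   Context: A pseudometric on $S$ is a function $m:S\times S\to[0,\infty)$ with $m(s,s)=0$, $m(s,t)=m(t,s)$ and $m(s,t)\leq m(s,u)+m(u,t)$; it is $1$-bounded if $m(s,t)\leq1$ for all $s,t$. $\mathcal{D}(S)$ is the set of probability distributions on $S$. For a $1$-bounded pseudometric $m$ on the finite set $S$ and $\Delta,\Theta\in\mathcal{D}(S)$, $\hat{m}(\Delta,\Theta)$ (the Kantorovich lifting) is the optimal value of the linear program: maximize $\sum_{s\in S}(\Delta(s)-\Theta(s))x_s$ over real variables $(x_s)_{s\in S}$ subject to $x_s-x_t\leq m(s,t)$ for all $s,t\in S$ and $0\leq x_s\leq 1$ for all $s\in S$. Lifting of relations: for $R\subseteq S\times S$, $\overline{R}\subseteq\mathcal{D}(S)\times\mathcal{D}(S)$ is the smallest relation such that (i) $s\,R\,t$ implies $\overline{s}\ \overline{R}\ \overline{t}$, where $\overline{s}$ is the point distribution at $s$; and (ii) if $I$ is finite, $p_i\ge0$, $\sum_{i\in I}p_i=1$ and $\Delta_i\ \overline{R}\ \Theta_i$ for all $i$, then $(\sum_i p_i\cdot\Delta_i)\ \overline{R}\ (\sum_i p_i\cdot\Theta_i)$ (pointwise convex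 combinations). *)

theory Defs
  imports "HOL-Probability.Probability_Mass_Function"
begin

definition pseudometric_on :: "'a set \<Rightarrow> ('a \<Rightarrow> 'a \<Rightarrow> real) \<Rightarrow> bool" where
  "pseudometric_on S m \<longleftrightarrow>
     (\<forall>s\<in>S. \<forall>t\<in>S. 0 \<le> m s t) \<and>
     (\<forall>s\<in>S. m s s = 0) \<and>
     (\<forall>s\<in>S. \<forall>t\<in>S. m s t = m t s) \<and>
     (\<forall>s\<in>S. \<forall>t\<in>S. \<forall>u\<in>S. m s t \<le> m s u + m u t)"

definition one_bounded_on :: "'a set \<Rightarrow> ('a \<Rightarrow> 'a \<Rightarrow> real) \<Rightarrow> bool" where
  "one_bounded_on S m \<longleftrightarrow> (\<forall>s\<in>S. \<forall>t\<in>S. m s t \<le> 1)"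

definition distributions :: "'a set \<Rightarrow> 'a pmf set" where
  "distributions S = {\<Delta>. set_pmf \<Delta> \<subseteq> S}"

definition kantorovich_feasible :: "'a set \<Rightarrow> ('a \<Rightarrow> 'a \<Rightarrow> real) \<Rightarrow> ('a \<Rightarrow> real) set" where
  "kantorovich_feasible S m =
     {x. (\<forall>s\<in>S. \<forall>t\<in>S. x s - x t \<le> m s t) \<and> (\<forall>s\<in>S. 0 \<le> x s \<and> x s \<le> 1)}"

text \<open>
  The optimal value of the linear program is taken as the supremum of the objective over the
  feasible region. For a pseudometric this is a supremum of a nonempty set that is bounded above,
  so the default value of \<^term>\<open>Sup\<close> on the reals plays no role; see
  \<open>kantorovich_upper\<close> and \<open>kantorovich_least\<close> below.
\<close>
definition kantorovich ::
    "'a set \<Rightarrow> ('a \<Rightarrow> 'a \<Rightarrow> real) \<Rightarrow> 'a pmf \<Rightarrow> 'a pmf \<Rightarrow> real" where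
  "kantorovich S m \<Delta> \<Theta> =
     (SUP x \<in> kantorovich_feasible S m. \<Sum>s\<in>S. (pmf \<Delta> s - pmf \<Theta> s) * x s)"

text \<open>
  The index set of a finite convex combination is a finite set of natural numbers, because an
  inductive definition cannot quantify over types; \<open>lifting_combination\<close> below gives the closure
  property for index sets of any type. The convex combinations \<open>\<Delta>\<close> and \<open>\<Theta>\<close> are described by
  their mass functions. When \<open>R \<subseteq> S \<times> S\<close>, all related distributions lie in
  \<open>distributions S\<close>, so the lifting need not mention \<open>S\<close>; see \<open>lifting_subset\<close>.
\<close>
inductive_set lifting :: "('a \<times> 'a) set \<Rightarrow> ('a pmf \<times> 'a pmf) set"
  for R :: "('a \<times> 'a) set"
where
  point: "(s, t) \<in> R \<Longrightarrow> (return_pmf s, return_pmf t) \<in> lifting R"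
| combination:
    "finite (I :: nat set) \<Longrightarrow> (\<And>i. i \<in> I \<Longrightarrow> 0 \<le> p i) \<Longrightarrow> (\<Sum>i\<in>I. p i) = 1 \<Longrightarrow>
     (\<And>i. i \<in> I \<Longrightarrow> (\<Delta>s i, \<Theta>s i) \<in> lifting R) \<Longrightarrow>
     (\<And>s. pmf \<Delta> s = (\<Sum>i\<in>I. p i * pmf (\<Delta>s i) s)) \<Longrightarrow>
     (\<And>s. pmf \<Theta> s = (\<Sum>i\<in>I. p i * pmf (\<Theta>s i) s)) \<Longrightarrow>
     (\<Delta>, \<Theta>) \<in> lifting R"

lemma lifting_combination:
  fixes I :: "'i set" and p :: "'i \<Rightarrow> real"
  assumes "finite I" and "\<And>i. i \<in> I \<Longrightarrow> 0 \<le> p i" and "(\<Sum>i\<in>I. p i) = 1"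
    and "\<And>i. i \<in> I \<Longrightarrow> (\<Delta>s i, \<Theta>s i) \<in> lifting R"
    and "\<And>s. pmf \<Delta> s = (\<Sum>i\<in>I. p i * pmf (\<Delta>s i) s)"
    and "\<And>s. pmf \<Theta> s = (\<Sum>i\<in>I. p i * pmf (\<Theta>s i) s)"
  shows "(\<Delta>, \<Theta>) \<in> lifting R"
proof -
  obtain h where h: "bij_betw h {0..<card I} I"
    using ex_bij_betw_nat_finite[OF assms(1)] by blast
  have hI: "h i \<in> I" if "i \<in> {0..<card I}" for i
    using h that bij_betwE by blast
  have re: "(\<Sum>i\<in>I. f i) = (\<Sum>j\<in>{0..<card I}. f (h j))" for f :: "'i \<Rightarrow> real"
    using sum.reindex_bij_betw[OF h, of f] by simp
  show ?thesis
    by (rule lifting.combination[where I = "{0..<card I}" and p = "p \<circ> h"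
          and \<Delta>s = "\<Delta>s \<circ> h" and \<Theta>s = "\<Theta>s \<circ> h"])
      (use hI assms re in \<open>auto simp del: atLeastLessThan_iff\<close>)
qed

lemma lifting_subset:
  assumes "R \<subseteq> S \<times> S"
  shows "lifting R \<subseteq> distributions S \<times> distributions S"
proof -
  have "set_pmf \<Delta> \<subseteq> S \<and> set_pmf \<Theta> \<subseteq> S" if "(\<Delta>, \<Theta>) \<in> lifting R" for \<Delta> \<Theta>
    using that
  proof induction
    case (point s t)
    then show ?case using assms by auto
  next
    case (combination I p \<Delta>s \<Theta>s \<Delta> \<Theta>)
    have 1: "pmf \<Delta> s = 0" "pmf \<Theta> s = 0" if "s \<notin> S" for s
    proof -
      have "pmf (\<Delta>s i) s = 0" "pmf (\<Theta>s i) s = 0" if "i \<in> I" for i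
        using combination.IH[OF that] \<open>s \<notin> S\<close> by (auto simp: pmf_eq_0_set_pmf)
      then show "pmf \<Delta> s = 0" "pmf \<Theta> s = 0"
        using combination.hyps by simp_all
    qed
    then show ?case unfolding subset_iff set_pmf_iff by blast
  qed
  then show ?thesis by (auto simp: distributions_def)
qed

lemma kantorovich_bdd_above:
  "bdd_above ((\<lambda>x. \<Sum>s\<in>S. (pmf \<Delta> s - pmf \<Theta> s) * x s) ` kantorovich_feasible S m)"
proof (rule bdd_aboveI2)
  fix x assume x: "x \<in> kantorovich_feasible S m"
  show "(\<Sum>s\<in>S. (pmf \<Delta> s - pmf \<Theta> s) * x s) \<le> (\<Sum>s\<in>S. \<bar>pmf \<Delta> s - pmf \<Theta> s\<bar>)"
  proof (rule sum_mono)
    fix s assume "s \<in> S"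
    then have "0 \<le> x s" "x s \<le> 1" using x by (auto simp: kantorovich_feasible_def)
    then have "\<bar>pmf \<Delta> s - pmf \<Theta> s\<bar> * x s \<le> \<bar>pmf \<Delta> s - pmf \<Theta> s\<bar>"
      by (simp add: mult_left_le)
    moreover have "(pmf \<Delta> s - pmf \<Theta> s) * x s \<le> \<bar>pmf \<Delta> s - pmf \<Theta> s\<bar> * x s"
      using \<open>0 \<le> x s\<close> by (intro mult_right_mono) auto
    ultimately show "(pmf \<Delta> s - pmf \<Theta> s) * x s \<le> \<bar>pmf \<Delta> s - pmf \<Theta> s\<bar>" by linarith
  qed
qed

lemma kantorovich_upper:
  "x \<in> kantorovich_feasible S m \<Longrightarrow>
     (\<Sum>s\<in>S. (pmf \<Delta> s - pmf \<Theta> s) * x s) \<le> kantorovich S m \<Delta> \<Theta>"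
  unfolding kantorovich_def by (rule cSUP_upper[OF _ kantorovich_bdd_above])

lemma kantorovich_least:
  assumes "pseudometric_on S m"
    and "\<And>x. x \<in> kantorovich_feasible S m \<Longrightarrow> (\<Sum>s\<in>S. (pmf \<Delta> s - pmf \<Theta> s) * x s) \<le> c"
  shows "kantorovich S m \<Delta> \<Theta> \<le> c"
proof -
  have "(\<lambda>_. 0) \<in> kantorovich_feasible S m"
    using assms(1) by (auto simp: kantorovich_feasible_def pseudometric_on_def)
  then show ?thesis
    unfolding kantorovich_def by (intro cSUP_least assms(2)) auto
qed

end

theory Submission
  imports Defs
begin

text \<open>
  As the kernel of a pseudometric, \<open>R\<close> is an equivalence relation. Feasible \<open>x\<close> are constant on
  its classes, so the objective vanishes on \<open>lifting R\<close>. Conversely, as \<open>S\<close> is finite, distinct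
  classes are at distance at least some \<open>\<epsilon> > 0\<close>, so \<open>\<epsilon>\<close> times the indicator of a class and of its
  complement are feasible; if the optimum is \<open>0\<close>, both distributions give every class the same
  mass. Within each class \<open>C\<close> the product coupling \<open>\<Delta> s * \<Theta> t / \<Delta> C\<close> then exhibits
  \<open>(\<Delta>, \<Theta>)\<close> as a convex combination of pairs of point distributions.
\<close>

lemma equiv_pseudometric_kernel:
  assumes "pseudometric_on S m" and "R \<subseteq> S \<times> S"
    and "\<And>s t. s \<in> S \<Longrightarrow> t \<in> S \<Longrightarrow> (s, t) \<in> R \<longleftrightarrow> m s t = 0"
  shows "equiv S R"
proof (rule equivI)
  have nonneg: "0 \<le> m s t" if "s \<in> S" "t \<in> S" for s t
    using assms(1) that unfolding pseudometric_on_def by blast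
  have tri: "m s t \<le> m s u + m u t" if "s \<in> S" "t \<in> S" "u \<in> S" for s t u
    using assms(1) that unfolding pseudometric_on_def by blast
  show "R \<subseteq> S \<times> S" by fact
  show "refl_on S R" using assms by (auto simp: refl_on_def pseudometric_on_def)
  have "(t, s) \<in> R" if "(s, t) \<in> R" for s t
    using that assms unfolding pseudometric_on_def by (metis mem_Sigma_iff subsetD)
  then show "sym R" by (auto intro: symI)
  show "trans R"
  proof (rule transI)
    fix s u t assume su: "(s, u) \<in> R" and ut: "(u, t) \<in> R"
    then have S: "s \<in> S" "u \<in> S" "t \<in> S" using assms(2) by auto
    have "m s u = 0" "m u t = 0" using su ut S assms(3) by auto
    then have "m s t = 0" using tri[of s t u] nonneg[of s t] S by simp
    then show "(s, t) \<in> R" using S assms(3) by blast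
  qed
qed

text \<open>Both sums are expectations of \<open>x\<close>, hence linear in the distribution. The
  inequality holds for point distributions by the assumption on \<open>x\<close>, and the
  nonnegative weights carry it over to convex combinations in the rule induction.\<close>

lemma lifting_sum_le:
  fixes x :: "'a \<Rightarrow> real"
  assumes "finite S" and "R \<subseteq> S \<times> S" and "\<And>s t. (s, t) \<in> R \<Longrightarrow> x s \<le> x t"
    and "(\<Delta>, \<Theta>) \<in> lifting R"
  shows "(\<Sum>s\<in>S. pmf \<Delta> s * x s) \<le> (\<Sum>s\<in>S. pmf \<Theta> s * x s)"
  using assms(4)
proof induction
  case (point s t)
  have "(\<Sum>r\<in>S. pmf (return_pmf u) r * x r) = x u" if "u \<in> S" for u
    using assms(1) that by (simp add: indicator_def if_distrib[where f = "\<lambda>c. c * _"] cong: if_cong)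
  then show ?case using point assms(2,3) by auto
next
  case (combination I p \<Delta>s \<Theta>s \<Delta> \<Theta>)
  have swap: "(\<Sum>s\<in>S. (\<Sum>i\<in>I. p i * pmf (\<Gamma> i) s) * x s) = (\<Sum>i\<in>I. p i * (\<Sum>s\<in>S. pmf (\<Gamma> i) s * x s))"
    for \<Gamma> :: "nat \<Rightarrow> 'a pmf"
    unfolding sum_distrib_left sum_distrib_right
    by (subst sum.swap) (simp add: mult.assoc)
  show ?case
    unfolding combination.hyps swap
    by (intro sum_mono mult_left_mono combination)
qed

text \<open>The first marginal of the product coupling, tested against an arbitrary
  \<open>f\<close>: constant \<open>f\<close> gives the total weight, and \<open>f\<close> equal to
  the mass that point distributions give to a fixed \<open>u\<close> gives the marginal at
  \<open>u\<close>. The second marginal follows by exchanging \<Delta> and \<Theta>.\<close>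

lemma sum_class_coupling:
  fixes \<Delta> \<Theta> :: "'a pmf" and f :: "'a \<Rightarrow> real"
  assumes "finite S" and "equiv S R"
    and eq: "\<And>s. s \<in> S \<Longrightarrow> measure_pmf.prob \<Delta> (R `` {s}) = measure_pmf.prob \<Theta> (R `` {s})"
  shows "(\<Sum>(s, t)\<in>R. pmf \<Delta> s * pmf \<Theta> t / measure_pmf.prob \<Delta> (R `` {s}) * f s) =
    (\<Sum>s\<in>S. pmf \<Delta> s * f s)"
proof -
  have RS: "R \<subseteq> S \<times> S" using assms(2) by (rule equiv_type)
  then have R: "R = Sigma S (\<lambda>s. R `` {s})" by auto
  have fin: "finite (R `` {s})" for s
    using RS assms(1) by (auto intro: finite_subset[of _ S])
  have inner: "(\<Sum>t\<in>R `` {s}. pmf \<Delta> s * pmf \<Theta> t / measure_pmf.prob \<Delta> (R `` {s}) * f s)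
      = pmf \<Delta> s * f s" if s: "s \<in> S" for s
  proof -
    let ?c = "measure_pmf.prob \<Delta> (R `` {s})"
    have c: "(\<Sum>t\<in>R `` {s}. pmf \<Theta> t) = ?c"
      using eq[OF s] by (simp add: measure_measure_pmf_finite fin)
    have "(\<Sum>t\<in>R `` {s}. pmf \<Delta> s * pmf \<Theta> t / ?c * f s) =
        (\<Sum>t\<in>R `` {s}. pmf \<Theta> t) * (pmf \<Delta> s / ?c * f s)"
      unfolding sum_distrib_right by (intro sum.cong) auto
    also have "\<dots> = ?c * (pmf \<Delta> s / ?c * f s)" unfolding c ..
    also have "\<dots> = pmf \<Delta> s * f s"
    proof (cases "?c = 0")
      \<comment> \<open>A class of mass 0 annihilates the left side whatever the quotient is. The
        right side is 0 too, because \<open>s\<close> lies in its own class and so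
        \<open>pmf \<Delta> s\<close> is at most \<open>?c\<close>.\<close>
      case True
      have "pmf \<Delta> s \<le> ?c"
        unfolding pmf.rep_eq using equiv_class_self[OF assms(2) s]
        by (intro measure_pmf.finite_measure_mono) auto
      then show ?thesis using True pmf_nonneg[of \<Delta> s] by simp
    qed simp
    finally show ?thesis .
  qed
  show ?thesis
    by (subst R, subst sum.Sigma[symmetric]) (simp_all add: assms(1) fin inner del: times_divide_eq_left)
qed

lemma lifting_if_prob_class_eq:
  assumes "finite S" and "equiv S R"
    and "\<Delta> \<in> distributions S" and "\<Theta> \<in> distributions S"
    and eq: "\<And>s. s \<in> S \<Longrightarrow> measure_pmf.prob \<Delta> (R `` {s}) = measure_pmf.prob \<Theta> (R `` {s})"
  shows "(\<Delta>, \<Theta>) \<in> lifting R"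
proof -
  let ?w = "\<lambda>(s, t). pmf \<Delta> s * pmf \<Theta> t / measure_pmf.prob \<Delta> (R `` {s})"
  have RS: "R \<subseteq> S \<times> S" using assms(2) by (rule equiv_type)
  have left: "(\<Sum>z\<in>R. ?w z * f (fst z)) = (\<Sum>s\<in>S. pmf \<Delta> s * f s)" for f :: "'a \<Rightarrow> real"
    using sum_class_coupling[OF assms(1,2) eq, of f] by (simp add: case_prod_beta)
  have right: "(\<Sum>z\<in>R. ?w z * f (snd z)) = (\<Sum>s\<in>S. pmf \<Theta> s * f s)" for f :: "'a \<Rightarrow> real"
  proof -
    \<comment> \<open>Related points have the same class, and \<Delta> and \<Theta> give it the same
      mass, so swapping the pairs turns \<open>?w\<close> into the coupling of \<Theta> with
      \<Delta>.\<close>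
    have "(\<Sum>z\<in>R. ?w z * f (snd z)) =
        (\<Sum>(s, t)\<in>R. pmf \<Theta> s * pmf \<Delta> t / measure_pmf.prob \<Theta> (R `` {s}) * f s)"
    proof (rule sum.reindex_bij_witness[where i = prod.swap and j = prod.swap])
      fix z assume z: "z \<in> R"
      then have "R `` {fst z} = R `` {snd z}"
        using equiv_class_eq[OF assms(2)] by (cases z) simp
      moreover have "snd z \<in> S" using z RS by auto
      ultimately show "(case prod.swap z of (s, t) \<Rightarrow>
          pmf \<Theta> s * pmf \<Delta> t / measure_pmf.prob \<Theta> (R `` {s}) * f s) = ?w z * f (snd z)"
        using eq by (cases z) (simp add: mult.commute)
    qed (use assms(2) in \<open>auto simp: equiv_def dest: symD\<close>)
    also have "\<dots> = (\<Sum>s\<in>S. pmf \<Theta> s * f s)"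
      by (rule sum_class_coupling[OF assms(1,2)]) (simp add: eq)
    finally show ?thesis .
  qed
  have point: "(\<Sum>s\<in>S. pmf \<Gamma> s * pmf (return_pmf s) u) = pmf \<Gamma> u"
    if "\<Gamma> \<in> distributions S" for \<Gamma> u
  proof -
    have "(\<Sum>s\<in>S. pmf \<Gamma> s * pmf (return_pmf s) u) = (\<Sum>s\<in>S. if s = u then pmf \<Gamma> s else 0)"
      by (intro sum.cong) (auto simp: indicator_def)
    also have "\<dots> = pmf \<Gamma> u"
      using that assms(1) by (auto simp: distributions_def pmf_eq_0_set_pmf)
    finally show ?thesis .
  qed
  have finR: "finite R" using RS assms(1) by (auto intro: finite_subset)
  show ?thesis
  \<comment> \<open>The index set is \<open>R\<close> itself: the pair \<open>(s, t)\<close>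
    contributes its two point distributions with weight \<open>?w (s, t)\<close>.\<close>
  proof (rule lifting_combination[where I = R and p = ?w
        and \<Delta>s = "return_pmf \<circ> fst" and \<Theta>s = "return_pmf \<circ> snd"])
    show "(\<Sum>z\<in>R. ?w z) = 1"
      using left[of "\<lambda>_. 1"] sum_pmf_eq_1[OF assms(1), of \<Delta>] assms(3)
      by (simp add: distributions_def)
    show "pmf \<Delta> u = (\<Sum>z\<in>R. ?w z * pmf ((return_pmf \<circ> fst) z) u)" for u
      using left[of "\<lambda>s. pmf (return_pmf s) u"] point[OF assms(3)] by simp
    show "pmf \<Theta> u = (\<Sum>z\<in>R. ?w z * pmf ((return_pmf \<circ> snd) z) u)" for u
      using right[of "\<lambda>s. pmf (return_pmf s) u"] point[OF assms(4)] by simp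
  qed (auto intro: finR lifting.point)
qed

lemma positive_values_lower_bound:
  fixes f :: "'a \<Rightarrow> real"
  assumes "finite A"
  obtains \<epsilon> where "0 < \<epsilon>" "\<epsilon> \<le> 1" "\<And>a. a \<in> A \<Longrightarrow> 0 < f a \<Longrightarrow> \<epsilon> \<le> f a"
proof
  \<comment> \<open>The extra element 1 keeps the set nonempty when \<open>f\<close> has no positive
    value on \<open>A\<close>, and caps the minimum at 1.\<close>
  let ?V = "insert 1 {v \<in> f ` A. 0 < v}"
  have "finite ?V" using assms by simp
  then show "0 < Min ?V" "Min ?V \<le> 1" "\<And>a. a \<in> A \<Longrightarrow> 0 < f a \<Longrightarrow> Min ?V \<le> f a"
    by (auto intro: Min_le simp del: Min_insert simp: Min_gr_iff)
qed

text \<open>By \<open>closed\<close>, \<open>A\<close> is a union of classes of points at distance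
  0. The conclusion is one-sided because the optimum bounds the objective only from above; the
  reverse inequality comes from applying the lemma to the complement.\<close>

lemma prob_closed_le_if_kantorovich_eq_0:
  assumes "finite S" and m: "pseudometric_on S m" and "kantorovich S m \<Delta> \<Theta> = 0"
    and "A \<subseteq> S" and closed: "\<And>s t. s \<in> A \<Longrightarrow> t \<in> S \<Longrightarrow> m s t = 0 \<Longrightarrow> t \<in> A"
  shows "measure_pmf.prob \<Delta> A \<le> measure_pmf.prob \<Theta> A"
proof -
  have nonneg: "0 \<le> m s t" if "s \<in> S" "t \<in> S" for s t
    using m that unfolding pseudometric_on_def by blast
  obtain \<epsilon> where \<epsilon>: "0 < \<epsilon>" "\<epsilon> \<le> 1"
    and le: "\<And>z. z \<in> S \<times> S \<Longrightarrow> 0 < case_prod m z \<Longrightarrow> \<epsilon> \<le> case_prod m z"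
    using positive_values_lower_bound[of "S \<times> S" "case_prod m"] assms(1) by blast
  let ?x = "\<lambda>s. \<epsilon> * indicator A s"
  have "?x s - ?x t \<le> m s t" if st: "s \<in> S" "t \<in> S" for s t
  \<comment> \<open>The difference is positive only when leaving \<open>A\<close>. There
    \<open>closed\<close> makes the distance nonzero, hence at least \<epsilon>.\<close>
  proof (cases "s \<in> A \<and> t \<notin> A")
    case True
    then have "m s t \<noteq> 0" using closed st by blast
    then have "0 < m s t" using nonneg[OF st] by simp
    then show ?thesis using le[of "(s, t)"] st True by simp
  next
    case False
    then show ?thesis using nonneg[OF st] \<epsilon>(1) by (auto simp: indicator_def)
  qed
  then have "?x \<in> kantorovich_feasible S m"
    using \<epsilon> by (auto simp: kantorovich_feasible_def indicator_def)
  from kantorovich_upper[OF this, of \<Delta> \<Theta>]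
  have "(\<Sum>s\<in>S. (pmf \<Delta> s - pmf \<Theta> s) * ?x s) \<le> 0" using assms(3) by simp
  moreover have "(\<Sum>s\<in>S. (pmf \<Delta> s - pmf \<Theta> s) * ?x s) = \<epsilon> * (\<Sum>s\<in>A. pmf \<Delta> s - pmf \<Theta> s)"
    unfolding sum_distrib_left
    using assms(1,4) by (intro sum.mono_neutral_cong_right) auto
  ultimately have "(\<Sum>s\<in>A. pmf \<Delta> s - pmf \<Theta> s) \<le> 0"
    using \<epsilon>(1) by (simp add: mult_le_0_iff)
  then show ?thesis
    using finite_subset[OF assms(4,1)] by (simp add: measure_measure_pmf_finite sum_subtractf)
qed

theorem theorem3p5:
  fixes S :: "'a set" and R :: "('a \<times> 'a) set" and m :: "'a \<Rightarrow> 'a \<Rightarrow> real"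
    and \<Delta> \<Theta> :: "'a pmf"
  assumes "finite S"
    and "R \<subseteq> S \<times> S"
    and "pseudometric_on S m"
    and "one_bounded_on S m"
    and "\<And>s t. s \<in> S \<Longrightarrow> t \<in> S \<Longrightarrow> (s, t) \<in> R \<longleftrightarrow> m s t = 0"
    and "\<Delta> \<in> distributions S"
    and "\<Theta> \<in> distributions S"
  shows "(\<Delta>, \<Theta>) \<in> lifting R \<longleftrightarrow> kantorovich S m \<Delta> \<Theta> = 0"
proof
  assume lift: "(\<Delta>, \<Theta>) \<in> lifting R"
  have "(\<Sum>s\<in>S. (pmf \<Delta> s - pmf \<Theta> s) * x s) \<le> 0" if x: "x \<in> kantorovich_feasible S m" for x
  proof -
    have "x s \<le> x t" if "(s, t) \<in> R" for s t
    proof -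
      have st: "s \<in> S" "t \<in> S" using that assms(2) by auto
      then have "x s - x t \<le> m s t" using x by (simp add: kantorovich_feasible_def)
      then show ?thesis using that st assms(5) by simp
    qed
    from lifting_sum_le[OF assms(1,2) this lift] show ?thesis
      by (simp add: left_diff_distrib sum_subtractf)
  qed
  then have "kantorovich S m \<Delta> \<Theta> \<le> 0" by (rule kantorovich_least[OF assms(3)])
  \<comment> \<open>The zero function is feasible with objective value 0.\<close>
  moreover have "0 \<le> kantorovich S m \<Delta> \<Theta>"
    using kantorovich_upper[of "\<lambda>_. 0" S m \<Delta> \<Theta>] assms(3)
    by (simp add: kantorovich_feasible_def pseudometric_on_def)
  ultimately show "kantorovich S m \<Delta> \<Theta> = 0" by simp
next
  assume K: "kantorovich S m \<Delta> \<Theta> = 0"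
  have eqv: "equiv S R" by (rule equiv_pseudometric_kernel[OF assms(3,2,5)])
  then have sym: "sym R" and trans: "trans R" by (auto simp: equiv_def)
  show "(\<Delta>, \<Theta>) \<in> lifting R"
  proof (rule lifting_if_prob_class_eq[OF assms(1) eqv assms(6,7)])
    fix s assume "s \<in> S"
    let ?C = "R `` {s}"
    have C: "?C \<subseteq> S" using assms(2) by auto
    have "measure_pmf.prob \<Delta> ?C \<le> measure_pmf.prob \<Theta> ?C"
    proof (rule prob_closed_le_if_kantorovich_eq_0[OF assms(1,3) K C])
      fix t u assume "t \<in> ?C" "u \<in> S" "m t u = 0"
      then show "u \<in> ?C" using C assms(5)[of t u] trans by (auto dest: transD)
    qed
    \<comment> \<open>Both distributions have total mass 1 on \<open>S\<close>, so this inequality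
      on the complement reverses the one on \<open>?C\<close>.\<close>
    moreover have "measure_pmf.prob \<Delta> (S - ?C) \<le> measure_pmf.prob \<Theta> (S - ?C)"
    proof (rule prob_closed_le_if_kantorovich_eq_0[OF assms(1,3) K])
      fix t u assume *: "t \<in> S - ?C" "u \<in> S" "m t u = 0"
      \<comment> \<open>If \<open>u\<close> were in \<open>?C\<close>, transitivity would put
        \<open>t\<close> there as well.\<close>
      then have "(u, t) \<in> R" using assms(5)[of t u] sym by (auto dest: symD)
      then show "u \<in> S - ?C" using * trans by (auto dest: transD)
    qed simp
    moreover have "measure_pmf.prob \<Gamma> (S - ?C) = 1 - measure_pmf.prob \<Gamma> ?C"
      if "\<Gamma> \<in> distributions S" for \<Gamma>
    proof -
      have "measure_pmf.prob \<Gamma> S = 1"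
        using that by (auto simp: distributions_def measure_pmf.prob_eq_1 AE_measure_pmf_iff)
      then show ?thesis using measure_pmf.finite_measure_Diff[of S \<Gamma> ?C] C by simp
    qed
    ultimately show "measure_pmf.prob \<Delta> ?C = measure_pmf.prob \<Theta> ?C"
      using assms(6,7) by simp
  qed
qed

end
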